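(* Let $f\colon\mathbb{R}^d\to\mathbb{R}$ be convex and differentiable with locally Lipschitz gradient $\nabla f$, and assume that $\min_{x\in\mathbb{R}^d} f(x)$ has a solution. Let $x^0\in\mathbb{R}^d$, $t_0>0$, $\theta_0>0$, $\delta\in(0,1)$, and let $\{\gamma_k\}_{k\ge1}$ be a sequence of real numbers with $\gamma_k\ge0$ and $\sum_{k=1}^\infty\gamma_k<\infty$. Let $\{x^k\}$ be generated by the method Extended BB_AdGD-2, that is, $x^{k+1}=x^k-t_k\nabla f(x^k)$ for $k\ge0$, where for $k\ge1$ $$t_k=\mathrm{mid}\{t_{BB},\,l_k^{(2)},\,u_k^{(2)}\},\qquad t_{BB}=\frac{(x^k-x^{k-1})^T(\nabla f(x^k)-\nabla f(x^{k-1}))}{\|\nabla f(x^k)-\nabla f(x^{k-1})\|^2}.$$ Then every accumulation point of $\{x^k\}$ is an optimal solution of $\min_{x\in\mathbb{R}^d}f(x)$.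
   Context: $\|\cdot\|$ is the Euclidean norm, $[t]_+=\max\{t,0\}$, and $\mathrm{mid}\{a,b,c\}$ is the median of three numbers. For $k\ge1$, $L_k=\dfrac{\|\nabla f(x^k)-\nabla f(x^{k-1})\|}{\|x^k-x^{k-1}\|}$, $\theta_k=\dfrac{t_k}{t_{k-1}}$ ($\theta_0$ is a given initial value), and $$l_k^{(2)}=\min\left\{\sqrt{\tfrac23+\theta_{k-1}}\,t_{k-1},\ \frac{\delta}{\sqrt2 L_k}\right\},\qquad u_k^{(2)}=\min\left\{\sqrt{\tfrac23+\theta_{k-1}}\,t_{k-1},\ \sqrt{\frac{1+\frac{\gamma_k}{\|x^k-x^{k-1}\|^2}}{[2t_{k-1}^2L_k^2-1]_+}}\;t_{k-1}\right\}.$$ Conventions: the iteration does not terminate, i.e. $\nabla f(x^k)\ne0$ for all $k$ (so $x^k\ne x^{k-1}$). A quotient $c/0$ with $c>0$ (when $L_k=0$ or $[2t_{k-1}^2L_k^2-1]_+=0$) is read as $+\infty$; if $L_k=0$ then $l_k^{(2)}=u_k^{(2)}=\sqrt{\tfrac23+\theta_{k-1}}\,t_{k-1}=t_k$ whatever value is assigned to $t_{BB}$. *)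

theory Defs
  imports "HOL-Analysis.Analysis"
begin

definition mid :: "real \<Rightarrow> real \<Rightarrow> real \<Rightarrow> real" where
  "mid a b c = sort [a, b, c] ! 1"

definition locally_lipschitz :: "('a::metric_space \<Rightarrow> 'b::metric_space) \<Rightarrow> bool" where
  "locally_lipschitz h \<longleftrightarrow> (\<forall>x. \<exists>r>0. \<exists>C. C-lipschitz_on (ball x r) h)"

definition accumulation_point :: "(nat \<Rightarrow> 'a::topological_space) \<Rightarrow> 'a \<Rightarrow> bool" where
  "accumulation_point X z \<longleftrightarrow> (\<exists>r. strict_mono r \<and> (X \<circ> r) \<longlonglongrightarrow> z)"

text \<open>Below, \<open>g\<close> is the gradient map, \<open>x\<close> the sequence of iterates and \<open>t\<close> the sequence of
  step sizes. The real quantities defined from them, except \<open>theta\<close>, are used for \<open>k \<ge> 1\<close> only.\<close>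

definition lip_est :: "('a::real_inner \<Rightarrow> 'a) \<Rightarrow> (nat \<Rightarrow> 'a) \<Rightarrow> nat \<Rightarrow> real" where
  "lip_est g x k = norm (g (x k) - g (x (k - 1))) / norm (x k - x (k - 1))"

definition theta :: "real \<Rightarrow> (nat \<Rightarrow> real) \<Rightarrow> nat \<Rightarrow> real" where
  "theta \<theta>0 t k = (if k = 0 then \<theta>0 else t k / t (k - 1))"

definition t_BB :: "('a::real_inner \<Rightarrow> 'a) \<Rightarrow> (nat \<Rightarrow> 'a) \<Rightarrow> nat \<Rightarrow> real" where
  "t_BB g x k = ((x k - x (k - 1)) \<bullet> (g (x k) - g (x (k - 1)))) / (norm (g (x k) - g (x (k - 1))))\<^sup>2"

definition growth_bound :: "real \<Rightarrow> (nat \<Rightarrow> real) \<Rightarrow> nat \<Rightarrow> real" where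
  "growth_bound \<theta>0 t k = sqrt (2 / 3 + theta \<theta>0 t (k - 1)) * t (k - 1)"

text \<open>In the two safeguards a quotient \<open>c / 0\<close> with \<open>c > 0\<close> stands for \<open>+\<infinity>\<close>, so that the minimum is
  then its other argument; since division by zero yields zero in HOL, this case is split off. If
  \<open>lip_est g x k = 0\<close>, both safeguards equal \<open>growth_bound \<theta>0 t k\<close>, and hence so does their median
  with \<open>t_BB g x k\<close>, whose value (zero in HOL) is then irrelevant.\<close>

definition l2 :: "('a::real_inner \<Rightarrow> 'a) \<Rightarrow> real \<Rightarrow> real \<Rightarrow> (nat \<Rightarrow> 'a) \<Rightarrow> (nat \<Rightarrow> real) \<Rightarrow> nat \<Rightarrow> real" where
  "l2 g \<delta> \<theta>0 x t k =
     (if lip_est g x k = 0 then growth_bound \<theta>0 t k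
      else min (growth_bound \<theta>0 t k) (\<delta> / (sqrt 2 * lip_est g x k)))"

definition u2 ::
  "('a::real_inner \<Rightarrow> 'a) \<Rightarrow> (nat \<Rightarrow> real) \<Rightarrow> real \<Rightarrow> (nat \<Rightarrow> 'a) \<Rightarrow> (nat \<Rightarrow> real) \<Rightarrow> nat \<Rightarrow> real" where
  "u2 g \<gamma> \<theta>0 x t k =
     (let D = max (2 * (t (k - 1))\<^sup>2 * (lip_est g x k)\<^sup>2 - 1) 0 in
      if D = 0 then growth_bound \<theta>0 t k
      else min (growth_bound \<theta>0 t k)
               (sqrt ((1 + \<gamma> k / (norm (x k - x (k - 1)))\<^sup>2) / D) * t (k - 1)))"

definition extended_BB_AdGD_2 ::
  "('a::real_inner \<Rightarrow> 'a) \<Rightarrow> real \<Rightarrow> (nat \<Rightarrow> real) \<Rightarrow> 'a \<Rightarrow> real \<Rightarrow> real \<Rightarrow> (nat \<Rightarrow> 'a) \<Rightarrow> (nat \<Rightarrow> real) \<Rightarrow> bool"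
where
  "extended_BB_AdGD_2 g \<delta> \<gamma> x0 t0 \<theta>0 x t \<longleftrightarrow>
     x 0 = x0 \<and> t 0 = t0 \<and>
     (\<forall>k. x (Suc k) = x k - t k *\<^sub>R g (x k)) \<and>
     (\<forall>k\<ge>1. t k = mid (t_BB g x k) (l2 g \<delta> \<theta>0 x t k) (u2 g \<gamma> \<theta>0 x t k))"

end

theory Submission
  imports Defs
begin

text \<open>
  Fix a minimiser \<open>s\<close> of \<open>f\<close> and write \<open>F k = f (x k) - f s\<close>. The proof is a Lyapunov argument for
  the energy
  \<open>E k = \<parallel>x (k+1) - s\<parallel>\<^sup>2 + (t k)\<^sup>2 \<parallel>g (x k)\<parallel>\<^sup>2 + (2 + 3 \<theta> k) t k F k\<close>.

  Expanding \<open>\<parallel>x (k+1) - s\<parallel>\<^sup>2\<close> leaves the term \<open>(t k)\<^sup>2 \<parallel>g (x k)\<parallel>\<^sup>2\<close> to be controlled. Convexity along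
  the last step bounds it by the previous gradient and the decrease of \<open>f\<close> (lemma
  \<open>gradient_step_energy\<close>), and the two upper bounds in the step rule are exactly what makes the
  resulting terms fit the previous energy: the growth bound \<open>(t (k+1))\<^sup>2 \<le> (2/3 + \<theta> k) (t k)\<^sup>2\<close>
  handles the function values, the curvature bound handles the gradients at the price of an error
  \<open>\<gamma> (k+1)\<close>. So
  \<open>E (k+1) + 2 t (k+1) (g (x (k+1)) \<bullet> (x (k+1) - s) - F (k+1)) \<le> E k + \<gamma> (k+1)\<close>.

  The extra term on the left is nonnegative by convexity, so the iterates stay bounded. Being bounded,
  they see only a bounded range of gradients and local Lipschitz constants, which has two
  consequences: the extra term is at least a multiple of \<open>t (k+1) \<parallel>g (x (k+1))\<parallel>\<^sup>2\<close> (lemma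
  \<open>local_cocoercivity_at_minimiser\<close>), and the steps stay away from zero (lemma
  \<open>growth_rule_bounded_below\<close>). Summing up, \<open>\<parallel>g (x k)\<parallel>\<^sup>2\<close> is summable, hence \<open>g (x k)\<close> tends to zero,
  and by continuity \<open>g\<close> vanishes at every accumulation point.
\<close>

section \<open>Convex functions and their gradients\<close>

lemma convex_gradient_inequality:
  fixes f :: "'a::real_inner \<Rightarrow> real"
  assumes conv: "convex_on UNIV f" and grad: "GDERIV f y :> D"
  shows "f w \<ge> f y + D \<bullet> (w - y)"
proof -
  define h where "h \<sigma> = f (y + \<sigma> *\<^sub>R (w - y))" for \<sigma> :: real
  have "convex_on UNIV h"
  proof (rule convex_onI)
    fix u a b :: real assume "0 < u" "u < 1"
    have "y + ((1 - u) *\<^sub>R a + u *\<^sub>R b) *\<^sub>R (w - y)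
        = (1 - u) *\<^sub>R (y + a *\<^sub>R (w - y)) + u *\<^sub>R (y + b *\<^sub>R (w - y))"
      by (simp add: algebra_simps)
    then show "h ((1 - u) *\<^sub>R a + u *\<^sub>R b) \<le> (1 - u) * h a + u * h b"
      unfolding h_def using convex_onD[OF conv, of u "y + a *\<^sub>R (w - y)" "y + b *\<^sub>R (w - y)"]
        \<open>0 < u\<close> \<open>u < 1\<close> by simp
  qed simp
  moreover have "(h has_real_derivative ((w - y) \<bullet> D)) (at 0)"
  proof -
    have "((\<lambda>\<sigma>. y + \<sigma> *\<^sub>R (w - y)) has_derivative (\<lambda>\<sigma>. \<sigma> *\<^sub>R (w - y))) (at 0)"
      by (auto intro!: derivative_eq_intros)
    moreover have "(f has_derivative (\<lambda>v. v \<bullet> D)) (at (y + 0 *\<^sub>R (w - y)))"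
      using grad by (simp add: gderiv_def)
    ultimately have "(h has_derivative (\<lambda>\<sigma>. (\<sigma> *\<^sub>R (w - y)) \<bullet> D)) (at 0)"
      unfolding h_def by (rule has_derivative_compose)
    then show ?thesis
      by (simp add: has_field_derivative_def mult.commute[of _ "(w - y) \<bullet> D"])
  qed
  ultimately have "h 1 - h 0 \<ge> (w - y) \<bullet> D * (1 - 0)"
    by (intro convex_on_imp_above_tangent[where A = UNIV]) auto
  then show ?thesis by (simp add: h_def inner_commute)
qed

lemma gradient_zero_iff_minimiser:
  fixes f :: "'a::real_inner \<Rightarrow> real"
  assumes "convex_on UNIV f" and grad: "GDERIV f y :> D"
  shows "D = 0 \<longleftrightarrow> (\<forall>w. f y \<le> f w)"
proof
  assume "D = 0"
  then show "\<forall>w. f y \<le> f w"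
    using convex_gradient_inequality[OF assms] by simp
next
  assume "\<forall>w. f y \<le> f w"
  then have "eventually (\<lambda>w. f y \<le> f w) (at y)" by (intro always_eventually)
  then have "(\<lambda>h. h \<bullet> D) = (\<lambda>h. 0)"
    using has_derivative_local_min[OF grad[unfolded gderiv_def]] by simp
  then have "D \<bullet> D = 0" by (rule fun_cong)
  then show "D = 0" by simp
qed

text \<open>If \<open>g\<close> were globally \<open>C\<close>-Lipschitz this would be the usual cocoercivity inequality between \<open>y\<close>
  and \<open>s\<close>. To get by with a Lipschitz constant near the minimiser, the two convexity inequalities are taken at the
  point \<open>s + \<sigma> g y\<close>, where \<open>\<sigma>\<close> is so small that this point lies in the given ball for every gradient
  of norm at most \<open>M\<close>; the point \<open>y\<close> itself may be far away.\<close>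

lemma local_cocoercivity_at_minimiser:
  fixes f :: "'a::real_inner \<Rightarrow> real"
  assumes conv: "convex_on UNIV f" and grad: "\<And>y. GDERIV f y :> g y"
    and lip: "locally_lipschitz g" and min: "\<forall>w. f s \<le> f w"
  obtains \<kappa> where "\<kappa> > 0"
    and "\<And>y. norm (g y) \<le> M \<Longrightarrow> g y \<bullet> (y - s) \<ge> f y - f s + \<kappa> * (norm (g y))\<^sup>2"
proof -
  obtain r C where r: "r > 0" and C: "C-lipschitz_on (ball s r) g"
    using lip unfolding locally_lipschitz_def by blast
  have C0: "C \<ge> 0" using C by (rule lipschitz_on_nonneg)
  have gs: "g s = 0" using gradient_zero_iff_minimiser[OF conv grad] min by blast
  define \<sigma> where "\<sigma> = min (r / (\<bar>M\<bar> + 1)) (1 / (2 * (C + 1)))"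
  have \<sigma>: "\<sigma> > 0" using r C0 by (simp add: \<sigma>_def)
  have "\<sigma> * C \<le> \<sigma> * (C + 1)" using \<sigma> by simp
  also have "\<dots> \<le> 1 / (2 * (C + 1)) * (C + 1)"
    using C0 by (intro mult_right_mono) (simp_all add: \<sigma>_def)
  also have "\<dots> = 1 / 2" using C0 by (simp add: divide_simps)
  finally have \<sigma>C: "\<sigma> * C \<le> 1 / 2" .
  show thesis
  proof
    show "\<sigma> / 2 > 0" using \<sigma> by simp
    fix y assume M: "norm (g y) \<le> M"
    define p where "p = s + \<sigma> *\<^sub>R g y"
    have "\<sigma> * norm (g y) < \<sigma> * (\<bar>M\<bar> + 1)" using \<sigma> M by simp
    also have "\<dots> \<le> r / (\<bar>M\<bar> + 1) * (\<bar>M\<bar> + 1)" by (intro mult_right_mono) (simp_all add: \<sigma>_def)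
    finally have "p \<in> ball s r" using \<sigma> by (simp add: p_def dist_norm)
    then have "norm (g p) \<le> C * (\<sigma> * norm (g y))"
      using lipschitz_onD[OF C, of p s] r gs \<sigma> by (simp add: p_def dist_norm)
    moreover have "g p \<bullet> g y \<le> norm (g p) * norm (g y)" by (rule norm_cauchy_schwarz)
    ultimately have "g p \<bullet> g y \<le> C * (\<sigma> * norm (g y)) * norm (g y)"
      by (meson mult_right_mono norm_ge_zero order_trans)
    also have "\<dots> = (\<sigma> * C) * (norm (g y))\<^sup>2" by (simp add: power2_eq_square)
    also have "\<dots> \<le> 1 / 2 * (norm (g y))\<^sup>2" using \<sigma>C by (intro mult_right_mono) auto
    finally have "\<sigma> * (g p \<bullet> g y) \<le> \<sigma> * (1 / 2 * (norm (g y))\<^sup>2)"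
      using \<sigma> by (simp only: mult_le_cancel_left_pos)
    moreover have "f s \<ge> f p - \<sigma> * (g p \<bullet> g y)"
      using convex_gradient_inequality[OF conv grad, of p s] by (simp add: p_def)
    moreover have "f p \<ge> f y - g y \<bullet> (y - s) + \<sigma> * (norm (g y))\<^sup>2"
      using convex_gradient_inequality[OF conv grad, of y p]
      by (simp add: p_def inner_diff_right inner_add_right power2_norm_eq_inner)
    ultimately show "g y \<bullet> (y - s) \<ge> f y - f s + \<sigma> / 2 * (norm (g y))\<^sup>2" by simp
  qed
qed

lemma locally_lipschitz_imp_lipschitz_on_compact:
  fixes h :: "'a::metric_space \<Rightarrow> 'b::metric_space"
  assumes "locally_lipschitz h" and "compact K"
  obtains C where "C-lipschitz_on K h"
proof -
  have "local_lipschitz {0::real} K (\<lambda>_. h)"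
  proof (rule local_lipschitzI)
    fix a assume "a \<in> K"
    obtain r C where "r > 0" and C: "C-lipschitz_on (ball a r) h"
      using assms(1) unfolding locally_lipschitz_def by blast
    then have "C-lipschitz_on (cball a (r / 2) \<inter> K) h"
      by (auto intro: lipschitz_on_subset[OF C])
    then show "\<exists>u>0. \<exists>L. \<forall>\<tau>\<in>cball \<tau> u \<inter> {0}. L-lipschitz_on (cball a u \<inter> K) h" for \<tau> :: real
      using \<open>r > 0\<close> by (intro exI[of _ "r / 2"]) auto
  qed
  then show thesis
    using local_lipschitz_compact_implies_lipschitz[OF _ assms(2), of "{0::real}" "\<lambda>_. h"] that
    by auto
qed

section \<open>The energy inequality\<close>

text \<open>With \<open>p = g a\<close> and \<open>q = g b\<close>, the identity \<open>\<parallel>q\<parallel>\<^sup>2 = \<parallel>q - p\<parallel>\<^sup>2 - \<parallel>p\<parallel>\<^sup>2 + 2 q \<bullet> p\<close> shifts the problem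
  to the product \<open>q \<bullet> p\<close>, for which convexity gives two bounds: \<open>\<tau> q \<bullet> p \<le> f a - f b\<close>, and
  \<open>q \<bullet> p \<le> \<parallel>p\<parallel>\<^sup>2\<close> by monotonicity of the gradient. Of the four copies of \<open>q \<bullet> p\<close> in \<open>2 \<parallel>q\<parallel>\<^sup>2\<close>, three are
  spent on the decrease of \<open>f\<close> and one on the other bound. This split is the source of both constants
  of the method: it yields \<open>2 \<tau>\<^sup>2 L\<^sup>2 - 1\<close> in the curvature bound, and the weight 3 that the growth
  factor \<open>2/3 + \<theta>\<close> compensates.\<close>

lemma gradient_step_energy:
  fixes f :: "'a::real_inner \<Rightarrow> real"
  assumes conv: "convex_on UNIV f" and grad: "\<And>y. GDERIV f y :> g y"
    and \<tau>: "\<tau> > 0" and ba: "b = a - \<tau> *\<^sub>R g a" and cb: "c = b - \<tau>' *\<^sub>R g b"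
    and curv: "\<tau>'\<^sup>2 * (2 * (norm (g b - g a))\<^sup>2 - (norm (g a))\<^sup>2) \<le> \<tau>\<^sup>2 * (norm (g a))\<^sup>2 + \<epsilon>"
  shows "(norm (c - s))\<^sup>2 + \<tau>'\<^sup>2 * (norm (g b))\<^sup>2 + 2 * \<tau>' * (g b \<bullet> (b - s))
    \<le> (norm (b - s))\<^sup>2 + \<tau>\<^sup>2 * (norm (g a))\<^sup>2 + \<epsilon> + 3 * (\<tau>'\<^sup>2 / \<tau>) * (f a - f b)"
proof -
  define P Q R where "P = g a \<bullet> g a" and "Q = g b \<bullet> g b" and "R = g b \<bullet> g a"
  have dec: "\<tau> * R \<le> f a - f b"
    using convex_gradient_inequality[OF conv grad, of b a] by (simp add: ba R_def)
  have "f b \<ge> f a - \<tau> * P"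
    using convex_gradient_inequality[OF conv grad, of a b] by (simp add: ba P_def)
  with dec have "\<tau> * R \<le> \<tau> * P" by linarith
  then have mono: "R \<le> P" using \<tau> by simp
  have "(norm (g b - g a))\<^sup>2 = Q + P - 2 * R"
    unfolding P_def Q_def R_def power2_norm_eq_inner
    by (simp add: inner_diff_left inner_diff_right inner_commute)
  then have "2 * Q \<le> (2 * (norm (g b - g a))\<^sup>2 - P) + 3 * R"
    using mono by simp
  then have "\<tau>'\<^sup>2 * (2 * Q) \<le> \<tau>'\<^sup>2 * ((2 * (norm (g b - g a))\<^sup>2 - P) + 3 * R)"
    by (rule mult_left_mono) simp
  also have "\<dots> \<le> \<tau>\<^sup>2 * P + \<epsilon> + 3 * (\<tau>'\<^sup>2 * R)"
    using curv by (simp add: algebra_simps P_def power2_norm_eq_inner)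
  also have "\<tau>'\<^sup>2 * R = \<tau>'\<^sup>2 / \<tau> * (\<tau> * R)" using \<tau> by simp
  also have "\<dots> \<le> \<tau>'\<^sup>2 / \<tau> * (f a - f b)"
    using dec \<tau> by (intro mult_left_mono) simp_all
  finally have "2 * (\<tau>'\<^sup>2 * Q) \<le> \<tau>\<^sup>2 * P + \<epsilon> + 3 * (\<tau>'\<^sup>2 / \<tau> * (f a - f b))" by simp
  moreover have "(norm (c - s))\<^sup>2 = (norm (b - s))\<^sup>2 - 2 * \<tau>' * (g b \<bullet> (b - s)) + \<tau>'\<^sup>2 * Q"
    unfolding power2_norm_eq_inner cb Q_def
    by (simp add: inner_diff_left inner_diff_right inner_commute algebra_simps power2_eq_square)
  moreover have norms: "(norm (g a))\<^sup>2 = P" "(norm (g b))\<^sup>2 = Q"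
    by (simp_all add: P_def Q_def power2_norm_eq_inner)
  ultimately show ?thesis unfolding norms mult.assoc by linarith
qed

lemma perturbed_descent_bounded_summable:
  fixes a b e :: "nat \<Rightarrow> real"
  assumes step: "\<And>k. a (Suc k) + b k \<le> a k + e k"
    and a: "\<And>k. a k \<ge> 0" and b: "\<And>k. b k \<ge> 0" and e: "\<And>k. e k \<ge> 0" "summable e"
  shows "a k \<le> a 0 + suminf e" and "summable b"
proof -
  have "a n + (\<Sum>k<n. b k) \<le> a 0 + (\<Sum>k<n. e k)" for n
  proof (induction n)
    case (Suc n)
    then show ?case using step[of n] by simp
  qed simp
  moreover have "(\<Sum>k<n. e k) \<le> suminf e" for n
    using e by (intro sum_le_suminf) auto
  ultimately have total: "a n + (\<Sum>k<n. b k) \<le> a 0 + suminf e" for n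
    by (meson add_left_mono order_trans)
  show "a k \<le> a 0 + suminf e"
    using total[of k] sum_nonneg[of "{..<k}" b] b by fastforce
  have "(\<Sum>k<n. b k) \<le> a 0 + suminf e" for n using total[of n] a[of n] by linarith
  then show "summable b" using b by (intro summableI_nonneg_bounded)
qed

section \<open>The step sizes\<close>

lemma mid_between: "l \<le> u \<Longrightarrow> l \<le> mid a l u \<and> mid a l u \<le> u"
  by (auto simp: mid_def)

text \<open>The growth factor is below 1 when \<open>\<theta> k < 1/3\<close>, so the steps can shrink without the lower safeguard
  \<open>B\<close> being active. But the factor is always at least \<open>\<surd>(2/3)\<close>, and so is the ratio \<open>\<theta>\<close> after a step
  governed by growth. A ratio below 1/3 therefore occurs only at the initial step or at a step of
  size at least \<open>B\<close>, and at most one factor \<open>\<surd>(2/3) > 1/2\<close> is lost below the level \<open>min B (t 0)\<close>. The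
  induction carries the disjunction because it is what excludes two losses in a row.\<close>

lemma growth_rule_bounded_below:
  fixes t :: "nat \<Rightarrow> real"
  assumes pos: "\<And>k. t k > 0" and \<theta>0: "\<theta>0 > 0" and B: "B > 0"
    and step: "\<And>k. t (Suc k) \<ge> growth_bound \<theta>0 t (Suc k) \<or> t (Suc k) \<ge> B"
  obtains c where "c > 0" and "\<And>k. t k \<ge> c"
proof -
  define c where "c = min B (t 0) / 2"
  have c: "c > 0" "2 * c \<le> B" "2 * c \<le> t 0" using B pos[of 0] by (auto simp: c_def)
  have \<theta>_nonneg: "theta \<theta>0 t k \<ge> 0" for k
    using \<theta>0 pos by (simp add: theta_def less_imp_le)
  have "t k \<ge> c \<and> (theta \<theta>0 t k \<ge> 1 / 3 \<or> t k \<ge> 2 * c)" for k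
  proof (induction k)
    case 0
    then show ?case using c by simp
  next
    case (Suc k)
    show ?case
    proof (cases "t (Suc k) \<ge> B")
      case True
      then show ?thesis using c by simp
    next
      case False
      define \<rho> where "\<rho> = sqrt (2 / 3 + theta \<theta>0 t k)"
      have grow: "t (Suc k) \<ge> \<rho> * t k"
        using False step[of k] by (simp add: growth_bound_def \<rho>_def)
      have half: "\<rho> \<ge> 1 / 2"
        unfolding \<rho>_def using \<theta>_nonneg[of k] by (intro real_le_rsqrt) (simp add: power2_eq_square)
      have "theta \<theta>0 t (Suc k) \<ge> \<rho>"
        using grow pos[of k] by (simp add: theta_def pos_le_divide_eq)
      moreover have "t (Suc k) \<ge> c"
      proof (cases "theta \<theta>0 t k \<ge> 1 / 3")
        case True
        then have "\<rho> \<ge> 1" by (simp add: \<rho>_def)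
        then have "1 * t k \<le> \<rho> * t k" using pos[of k] by (intro mult_right_mono) simp_all
        then show ?thesis using grow Suc.IH by simp
      next
        case False
        then have "t k \<ge> 2 * c" using Suc.IH by simp
        then have "1 / 2 * (2 * c) \<le> \<rho> * t k" using half c by (intro mult_mono) simp_all
        then show ?thesis using grow by simp
      qed
      ultimately show ?thesis using half by simp
    qed
  qed
  then show thesis using that c by blast
qed

text \<open>The lower safeguard never exceeds the upper one: where the curvature quotient is finite, its
  denominator satisfies \<open>D \<le> 2 (t k)\<^sup>2 L\<^sup>2\<close> and its numerator is at least 1, so it is at least
  \<open>1 / (\<surd>2 L)\<close>, which beats \<open>\<delta> / (\<surd>2 L)\<close>.\<close>

lemma l2_le_u2:
  fixes x :: "nat \<Rightarrow> 'a::real_inner"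
  assumes tk: "t k > 0" and \<delta>: "0 < \<delta>" "\<delta> < 1" and \<gamma>: "\<gamma> (Suc k) \<ge> 0"
  shows "l2 g \<delta> \<theta>0 x t (Suc k) \<le> u2 g \<gamma> \<theta>0 x t (Suc k)"
proof -
  define L where "L = lip_est g x (Suc k)"
  define D where "D = max (2 * (t k)\<^sup>2 * L\<^sup>2 - 1) 0"
  define N where "N = 1 + \<gamma> (Suc k) / (norm (x (Suc k) - x k))\<^sup>2"
  have L0: "L \<ge> 0" by (simp add: L_def lip_est_def)
  have "\<delta> / (sqrt 2 * L) \<le> sqrt (N / D) * t k" if "D \<noteq> 0" "L \<noteq> 0"
  proof -
    have D: "D > 0" "D \<le> 2 * (t k)\<^sup>2 * L\<^sup>2" using that by (auto simp: D_def)
    have Lp: "L > 0" using L0 that by simp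
    have "1 / (sqrt 2 * L * t k) = sqrt (1 / (2 * (t k)\<^sup>2 * L\<^sup>2))"
      using Lp tk by (simp add: real_sqrt_divide real_sqrt_mult)
    also have "\<dots> \<le> sqrt (N / D)"
      using D \<gamma> by (intro real_sqrt_le_mono frac_le) (simp_all add: N_def)
    finally have "1 / (sqrt 2 * L * t k) * t k \<le> sqrt (N / D) * t k"
      using tk by (intro mult_right_mono) simp_all
    moreover have "\<delta> / (sqrt 2 * L) \<le> 1 / (sqrt 2 * L)"
      using \<delta> Lp by (intro divide_right_mono) simp_all
    ultimately show ?thesis using tk by simp
  qed
  moreover have "D = 0" if "L = 0" using that by (simp add: D_def)
  ultimately show ?thesis
    unfolding l2_def u2_def Let_def
    by (auto simp flip: L_def simp: D_def N_def min_le_iff_disj)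
qed

text \<open>The curvature bound in the form that the energy estimate needs. Clearing the denominator \<open>D\<close> makes
  the truncation harmless, since a nonpositive left-hand side satisfies the inequality anyway.
  Because \<open>\<parallel>x (k+1) - x k\<parallel> = t k \<parallel>g (x k)\<parallel>\<close>, the relative error \<open>\<gamma> (k+1) / \<parallel>x (k+1) - x k\<parallel>\<^sup>2\<close> becomes the
  absolute error \<open>\<gamma> (k+1)\<close>, which is summable.\<close>

lemma u2_curvature:
  fixes x :: "nat \<Rightarrow> 'a::real_inner"
  assumes tk: "t k > 0" and \<tau>: "0 < \<tau>" "\<tau> \<le> u2 g \<gamma> \<theta>0 x t (Suc k)" and \<gamma>: "\<gamma> (Suc k) \<ge> 0"
    and x: "x (Suc k) = x k - t k *\<^sub>R g (x k)" and g: "g (x k) \<noteq> 0"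
  shows "\<tau>\<^sup>2 * (2 * (norm (g (x (Suc k)) - g (x k)))\<^sup>2 - (norm (g (x k)))\<^sup>2)
    \<le> (t k)\<^sup>2 * (norm (g (x k)))\<^sup>2 + \<gamma> (Suc k)"
proof -
  define n where "n = norm (g (x k))"
  define L where "L = lip_est g x (Suc k)"
  define D where "D = max (2 * (t k)\<^sup>2 * L\<^sup>2 - 1) 0"
  define N where "N = 1 + \<gamma> (Suc k) / (norm (x (Suc k) - x k))\<^sup>2"
  have n: "n > 0" using g by (simp add: n_def)
  have dx: "norm (x (Suc k) - x k) = t k * n" using tk by (simp add: x n_def)
  have dg: "norm (g (x (Suc k)) - g (x k)) = L * (t k * n)"
    using dx n tk by (simp add: L_def lip_est_def)
  have N: "N \<ge> 0" using \<gamma> by (simp add: N_def)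
  have "\<tau>\<^sup>2 * D \<le> N * (t k)\<^sup>2"
  proof (cases "D = 0")
    case True
    then show ?thesis using N by simp
  next
    case False
    then have D: "D > 0" by (simp add: D_def)
    have "u2 g \<gamma> \<theta>0 x t (Suc k)
        = (if D = 0 then growth_bound \<theta>0 t (Suc k)
           else min (growth_bound \<theta>0 t (Suc k)) (sqrt (N / D) * t k))"
      unfolding u2_def Let_def D_def N_def L_def by simp
    then have "\<tau> \<le> sqrt (N / D) * t k" using \<tau> False by simp
    then have "\<tau>\<^sup>2 \<le> (sqrt (N / D) * t k)\<^sup>2" using \<tau> by (intro power_mono) simp_all
    also have "\<dots> = N * (t k)\<^sup>2 / D" using N D by (simp add: power_mult_distrib)
    finally show ?thesis using D by (simp add: pos_le_divide_eq)
  qed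
  moreover have "\<tau>\<^sup>2 * (2 * (t k)\<^sup>2 * L\<^sup>2 - 1) \<le> \<tau>\<^sup>2 * D"
    by (intro mult_left_mono) (simp_all add: D_def)
  ultimately have "\<tau>\<^sup>2 * (2 * (t k)\<^sup>2 * L\<^sup>2 - 1) * n\<^sup>2 \<le> N * (t k)\<^sup>2 * n\<^sup>2"
    by (intro mult_right_mono) simp_all
  moreover have "N * (t k)\<^sup>2 * n\<^sup>2 = (t k)\<^sup>2 * n\<^sup>2 + \<gamma> (Suc k)"
    using n tk unfolding N_def dx by (simp add: field_simps)
  ultimately show ?thesis
    unfolding dg by (simp flip: n_def add: power_mult_distrib algebra_simps)
qed

text \<open>All that the convergence proof uses of the step rule: a median of three numbers lies between any
  two of them, here the two safeguards.\<close>

lemma extended_BB_step: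
  fixes x :: "nat \<Rightarrow> 'a::real_inner"
  assumes iterates: "extended_BB_AdGD_2 g \<delta> \<gamma> x0 t0 \<theta>0 x t"
    and params: "t0 > 0" "\<theta>0 > 0" "0 < \<delta>" "\<delta> < 1"
    and \<gamma>: "\<And>k. k \<ge> 1 \<Longrightarrow> \<gamma> k \<ge> 0"
  shows "t k > 0"
    and "l2 g \<delta> \<theta>0 x t (Suc k) \<le> t (Suc k)"
    and "t (Suc k) \<le> u2 g \<gamma> \<theta>0 x t (Suc k)"
proof -
  have between: "l2 g \<delta> \<theta>0 x t (Suc k) \<le> t (Suc k) \<and> t (Suc k) \<le> u2 g \<gamma> \<theta>0 x t (Suc k)"
    if "t k > 0" for k
  proof -
    have "t (Suc k) = mid (t_BB g x (Suc k)) (l2 g \<delta> \<theta>0 x t (Suc k)) (u2 g \<gamma> \<theta>0 x t (Suc k))"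
      using iterates by (simp add: extended_BB_AdGD_2_def)
    then show ?thesis
      using mid_between[OF l2_le_u2[where t = t and k = k and \<gamma> = \<gamma>]] that params \<gamma> by simp
  qed
  have pos: "t k > 0 \<and> theta \<theta>0 t k > 0" for k
  proof (induction k)
    case 0
    then show ?case using iterates params by (simp add: extended_BB_AdGD_2_def theta_def)
  next
    case (Suc k)
    have "lip_est g x (Suc k) \<ge> 0" by (simp add: lip_est_def)
    moreover have "growth_bound \<theta>0 t (Suc k) > 0"
      using Suc by (simp add: growth_bound_def add_pos_pos)
    ultimately have "l2 g \<delta> \<theta>0 x t (Suc k) > 0" using params by (simp add: l2_def)
    then have "t (Suc k) > 0" using between[of k] Suc by linarith
    then show ?case using Suc by (simp add: theta_def)
  qed
  show "t k > 0" using pos by blast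
  show "l2 g \<delta> \<theta>0 x t (Suc k) \<le> t (Suc k)" "t (Suc k) \<le> u2 g \<gamma> \<theta>0 x t (Suc k)"
    using between pos by blast+
qed

section \<open>Convergence\<close>

theorem mainTheorem4:
  fixes f :: "real ^ 'd \<Rightarrow> real"
    and g :: "real ^ 'd \<Rightarrow> real ^ 'd"
    and x :: "nat \<Rightarrow> real ^ 'd" and x0 z :: "real ^ 'd"
    and t \<gamma> :: "nat \<Rightarrow> real" and t0 \<theta>0 \<delta> :: real
  assumes "convex_on UNIV f"
    and "\<And>y. GDERIV f y :> g y"
    and "locally_lipschitz g"
    and "\<exists>xs. \<forall>y. f xs \<le> f y"
    and "t0 > 0" and "\<theta>0 > 0" and "0 < \<delta>" and "\<delta> < 1"
    and "\<And>k. k \<ge> 1 \<Longrightarrow> \<gamma> k \<ge> 0"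
    and "summable (\<lambda>k. \<gamma> (Suc k))"
    and "extended_BB_AdGD_2 g \<delta> \<gamma> x0 t0 \<theta>0 x t"
    and "\<And>k. g (x k) \<noteq> 0"
    and "accumulation_point x z"
  shows "\<forall>y. f z \<le> f y"
proof -
  note conv = assms(1) and grad = assms(2) and lip = assms(3)
  note step = extended_BB_step[OF assms(11) assms(5-9)]
  note pos = step(1)
  have iter: "x (Suc k) = x k - t k *\<^sub>R g (x k)" for k
    using assms(11) by (simp add: extended_BB_AdGD_2_def)
  have \<gamma>: "\<gamma> (Suc k) \<ge> 0" for k using assms(9) by simp
  obtain s where min: "\<forall>y. f s \<le> f y" using assms(4) by blast
  define \<theta> where "\<theta> = theta \<theta>0 t"
  have \<theta>: "\<theta> k > 0" for k
    using pos assms(6) by (simp add: \<theta>_def theta_def)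
  have grow: "t (Suc k) \<le> sqrt (2 / 3 + \<theta> k) * t k" for k
  proof -
    have "u2 g \<gamma> \<theta>0 x t (Suc k) \<le> growth_bound \<theta>0 t (Suc k)" by (simp add: u2_def Let_def)
    then show ?thesis using step(3)[of k] by (simp add: growth_bound_def \<theta>_def)
  qed
  define E where "E k = (norm (x (Suc k) - s))\<^sup>2 + (t k)\<^sup>2 * (norm (g (x k)))\<^sup>2
    + (2 + 3 * \<theta> k) * t k * (f (x k) - f s)" for k
  define A where "A k = g (x k) \<bullet> (x k - s) - (f (x k) - f s)" for k
  have A: "A k \<ge> 0" for k
    using convex_gradient_inequality[OF conv grad, of "x k" s]
    by (simp add: A_def inner_diff_right)
  have F: "f (x k) - f s \<ge> 0" for k using min by simp
  have energy: "E (Suc k) + 2 * t (Suc k) * A (Suc k) \<le> E k + \<gamma> (Suc k)" for k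
  proof -
    have "(norm (x (Suc (Suc k)) - s))\<^sup>2 + (t (Suc k))\<^sup>2 * (norm (g (x (Suc k))))\<^sup>2
        + 2 * t (Suc k) * (g (x (Suc k)) \<bullet> (x (Suc k) - s))
      \<le> (norm (x (Suc k) - s))\<^sup>2 + (t k)\<^sup>2 * (norm (g (x k)))\<^sup>2 + \<gamma> (Suc k)
        + 3 * ((t (Suc k))\<^sup>2 / t k) * (f (x k) - f (x (Suc k)))"
      by (rule gradient_step_energy[OF conv grad pos iter iter
            u2_curvature[OF pos pos step(3) \<gamma> iter assms(12)]])
    moreover have ratio: "(t (Suc k))\<^sup>2 / t k = \<theta> (Suc k) * t (Suc k)"
      by (simp add: \<theta>_def theta_def power2_eq_square)
    moreover have "3 * ((t (Suc k))\<^sup>2 / t k) * (f (x k) - f s)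
        \<le> (2 + 3 * \<theta> k) * t k * (f (x k) - f s)"
    proof (rule mult_right_mono[OF _ F])
      have "(t (Suc k))\<^sup>2 \<le> (sqrt (2 / 3 + \<theta> k) * t k)\<^sup>2"
        using grow[of k] pos[of "Suc k"] by (intro power_mono) simp_all
      also have "\<dots> = (2 / 3 + \<theta> k) * (t k)\<^sup>2"
        using \<theta>[of k] by (simp add: power_mult_distrib)
      finally have "(t (Suc k))\<^sup>2 / t k \<le> (2 / 3 + \<theta> k) * (t k)\<^sup>2 / t k"
        using pos[of k] by (intro divide_right_mono) simp_all
      also have "\<dots> = (2 / 3 + \<theta> k) * t k" using pos[of k] by (simp add: power2_eq_square)
      finally show "3 * ((t (Suc k))\<^sup>2 / t k) \<le> (2 + 3 * \<theta> k) * t k" by (simp add: algebra_simps)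
    qed
    ultimately show ?thesis
      unfolding E_def A_def ratio by (simp add: algebra_simps)
  qed
  have E_ge: "E k \<ge> (norm (x (Suc k) - s))\<^sup>2" for k
    using F[of k] pos[of k] \<theta>[of k] by (simp add: E_def)
  have E0: "E k \<ge> 0" for k using E_ge[of k] zero_le_power2 order_trans by blast
  have slack0: "2 * t (Suc k) * A (Suc k) \<ge> 0" for k
    using pos[of "Suc k"] A[of "Suc k"] by simp
  note descent = perturbed_descent_bounded_summable[OF energy E0 slack0 \<gamma> assms(10)]

  define K where "K = cball s (norm (x 0 - s) + sqrt (E 0 + (\<Sum>k. \<gamma> (Suc k))))"
  have "compact K" by (simp add: K_def)
  have xK: "x k \<in> K" for k
  proof (cases k)
    case 0
    have "0 \<le> E 0 + (\<Sum>k. \<gamma> (Suc k))" using descent(1)[of 0] E0[of 0] by linarith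
    then show ?thesis by (simp add: 0 K_def dist_norm norm_minus_commute)
  next
    case (Suc m)
    have "norm (x k - s) \<le> sqrt (E 0 + (\<Sum>k. \<gamma> (Suc k)))"
      using E_ge[of m] descent(1)[of m] unfolding Suc by (intro real_le_rsqrt) linarith
    also have "\<dots> \<le> norm (x 0 - s) + sqrt (E 0 + (\<Sum>k. \<gamma> (Suc k)))" by simp
    finally show ?thesis by (simp add: K_def dist_norm norm_minus_commute)
  qed
  obtain C where C: "C-lipschitz_on K g"
    using locally_lipschitz_imp_lipschitz_on_compact[OF lip \<open>compact K\<close>] .
  have "bounded (g ` K)"
    using lipschitz_on_continuous_on[OF C] \<open>compact K\<close>
    by (intro compact_imp_bounded compact_continuous_image)
  then obtain M where M: "norm (g (x k)) \<le> M" for k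
    using xK unfolding bounded_iff by blast
  obtain \<kappa> where \<kappa>: "\<kappa> > 0"
    and coco: "\<And>y. norm (g y) \<le> M \<Longrightarrow> g y \<bullet> (y - s) \<ge> f y - f s + \<kappa> * (norm (g y))\<^sup>2"
    using local_cocoercivity_at_minimiser[OF conv grad lip min] by blast

  define B where "B = \<delta> / (sqrt 2 * (C + 1))"
  have C0: "C \<ge> 0" using C by (rule lipschitz_on_nonneg)
  have "B > 0" using C0 assms(7) by (simp add: B_def)
  moreover have "t (Suc k) \<ge> growth_bound \<theta>0 t (Suc k) \<or> t (Suc k) \<ge> B" for k
  proof (cases "lip_est g x (Suc k) = 0")
    case True
    then show ?thesis using step(2)[of k] by (simp add: l2_def)
  next
    case False
    then have L: "lip_est g x (Suc k) > 0" by (simp add: lip_est_def less_le)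
    have "lip_est g x (Suc k) \<le> C"
      using lipschitz_onD[OF C xK xK, of "Suc k" k] L
      by (auto simp: lip_est_def dist_norm divide_le_eq)
    then have "B \<le> \<delta> / (sqrt 2 * lip_est g x (Suc k))"
      unfolding B_def using L assms(7) by (intro frac_le mult_left_mono) simp_all
    then show ?thesis using step(2)[of k] False by (auto simp: l2_def min_def split: if_splits)
  qed
  ultimately obtain c where c: "c > 0" and tc: "\<And>k. t k \<ge> c"
    using growth_rule_bounded_below[where t = t, OF pos assms(6)] by blast

  have "summable (\<lambda>k. (2 * c * \<kappa>) * (norm (g (x (Suc k))))\<^sup>2)"
  proof (rule summable_comparison_test'[OF descent(2)])
    fix k
    have "2 * c * (\<kappa> * (norm (g (x (Suc k))))\<^sup>2) \<le> 2 * t (Suc k) * A (Suc k)"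
      using coco[OF M[of "Suc k"]] tc[of "Suc k"] c \<kappa> by (intro mult_mono) (simp_all add: A_def)
    then show "norm ((2 * c * \<kappa>) * (norm (g (x (Suc k))))\<^sup>2) \<le> 2 * t (Suc k) * A (Suc k)"
      using c \<kappa> by (simp add: mult.assoc)
  qed
  then have "summable (\<lambda>k. (norm (g (x (Suc k))))\<^sup>2)"
    using c \<kappa> by (simp add: summable_cmult_iff)
  then have "(\<lambda>k. (norm (g (x (Suc k))))\<^sup>2) \<longlonglongrightarrow> 0" by (rule summable_LIMSEQ_zero)
  then have "(\<lambda>k. sqrt ((norm (g (x (Suc k))))\<^sup>2)) \<longlonglongrightarrow> sqrt 0" by (rule tendsto_real_sqrt)
  then have g0: "(\<lambda>k. g (x k)) \<longlonglongrightarrow> 0"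
    by (simp add: tendsto_norm_zero_iff LIMSEQ_imp_Suc)

  obtain r where r: "strict_mono r" "(x \<circ> r) \<longlonglongrightarrow> z"
    using assms(13) unfolding accumulation_point_def by blast
  have "z \<in> K"
    using closed_sequentially[OF compact_imp_closed[OF \<open>compact K\<close>] _ r(2)] xK by simp
  then have "(\<lambda>k. g ((x \<circ> r) k)) \<longlonglongrightarrow> g z"
    using continuous_on_tendsto_compose[OF lipschitz_on_continuous_on[OF C] r(2)] xK by simp
  moreover have "(\<lambda>k. g ((x \<circ> r) k)) \<longlonglongrightarrow> 0"
    using LIMSEQ_subseq_LIMSEQ[OF g0 r(1)] by (simp add: o_def)
  ultimately have "g z = 0" by (rule LIMSEQ_unique)
  then show ?thesis using gradient_zero_iff_minimiser[OF conv grad] by blast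
qed

end
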